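(* Let $\mathfrak{c}$ denote the cardinality of the continuum. The topological group $\mathbb{Z}^{\mathfrak{c}}$ contains a countable closed non-reflexive subgroup (with the subspace topology).
   Context: $\mathbb{Z}$ is the group of integers with the discrete topology, and $\mathbb{Z}^{\mathfrak{c}}$ is the product of $\mathfrak{c}$ many copies of $\mathbb{Z}$ with the Tychonoff product topology. $\mathbb{T}=\mathbb{R}/\mathbb{Z}$ is the circle group. For an abelian topological group $H$, the (Pontryagin) dual group $\widehat{H}$ is the group of all continuous homomorphisms $H\to\mathbb{T}$ with pointwise addition, equipped with the compact-open topology. An abelian topological group $H$ is called reflexive if its second Pontryagin dual $\widehat{\widehat{H}}$ is topologically isomorphic to $H$; it is non-reflexive otherwise. *)

theory Defs
  imports "HOL-Analysis.Analysis" "HOL-Algebra.Product_Groups"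
begin

text \<open>
  A topological group is given by a group \<open>G\<close> together with a topology \<open>T\<close> on its carrier.
  Groups are written multiplicatively, as everywhere in HOL-Algebra, also when the operation
  is addition.
\<close>

definition top_isomorphic ::
    "'a monoid \<Rightarrow> 'a topology \<Rightarrow> 'b monoid \<Rightarrow> 'b topology \<Rightarrow> bool" where
  "top_isomorphic G T G' T' \<longleftrightarrow> (\<exists>f. f \<in> iso G G' \<and> homeomorphic_map T T' f)"

definition real_group :: "real monoid" where
  "real_group = \<lparr>carrier = UNIV, monoid.mult = (+), one = 0\<rparr>"

definition circle_group :: "real set monoid" where
  "circle_group = real_group Mod \<int>"

definition circle_topology :: "real set topology" where
  "circle_topology =
     topology (\<lambda>U. U \<subseteq> carrier circle_group \<and> open {x. \<int> #>\<^bsub>real_group\<^esub> x \<in> U})"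

text \<open>The defining condition is a topology, and the result is the quotient topology.\<close>

lemma openin_circle_topology:
  "openin circle_topology U \<longleftrightarrow>
     U \<subseteq> carrier circle_group \<and> open {x. \<int> #>\<^bsub>real_group\<^esub> x \<in> U}"
proof -
  have "istopology (\<lambda>U. U \<subseteq> carrier circle_group \<and> open {x. \<int> #>\<^bsub>real_group\<^esub> x \<in> U})"
    unfolding istopology_def
  proof (intro conjI allI impI)
    fix S T
    assume "S \<subseteq> carrier circle_group \<and> open {x. \<int> #>\<^bsub>real_group\<^esub> x \<in> S}"
      and "T \<subseteq> carrier circle_group \<and> open {x. \<int> #>\<^bsub>real_group\<^esub> x \<in> T}"
    then show "S \<inter> T \<subseteq> carrier circle_group" "open {x. \<int> #>\<^bsub>real_group\<^esub> x \<in> S \<inter> T}"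
      using open_Int by (auto simp: Collect_conj_eq)
  next
    fix \<K>
    assume "\<forall>K\<in>\<K>. K \<subseteq> carrier circle_group \<and> open {x. \<int> #>\<^bsub>real_group\<^esub> x \<in> K}"
    moreover have "{x. \<int> #>\<^bsub>real_group\<^esub> x \<in> \<Union>\<K>} = (\<Union>K\<in>\<K>. {x. \<int> #>\<^bsub>real_group\<^esub> x \<in> K})"
      by auto
    ultimately show "\<Union>\<K> \<subseteq> carrier circle_group" "open {x. \<int> #>\<^bsub>real_group\<^esub> x \<in> \<Union>\<K>}"
      by auto
  qed
  then show ?thesis
    by (simp add: circle_topology_def)
qed

lemma topspace_circle_topology [simp]: "topspace circle_topology = carrier circle_group"
proof -
  have "{x. \<int> #>\<^bsub>real_group\<^esub> x \<in> carrier circle_group} = UNIV"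
    by (auto simp: circle_group_def carrier_FactGroup real_group_def)
  then have "openin circle_topology (carrier circle_group)"
    by (simp add: openin_circle_topology)
  then show ?thesis
    by (metis openin_circle_topology openin_subset openin_topspace subset_antisym)
qed

lemma quotient_map_circle:
  "quotient_map euclidean circle_topology (\<lambda>x. \<int> #>\<^bsub>real_group\<^esub> x)"
  by (auto simp: quotient_map_def openin_circle_topology circle_group_def carrier_FactGroup
      real_group_def)

text \<open>
  A character is a function on the carrier of \<open>G\<close>; being a total function in HOL, it is taken
  to be \<open>undefined\<close> elsewhere, so that distinct functions are distinct characters.
\<close>

definition dual_group :: "'a monoid \<Rightarrow> 'a topology \<Rightarrow> ('a \<Rightarrow> real set) monoid" where
  "dual_group G T =
     \<lparr>carrier = {\<phi> \<in> hom G circle_group.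
                  \<phi> \<in> extensional (carrier G) \<and> continuous_map T circle_topology \<phi>},
      monoid.mult = (\<lambda>\<phi> \<psi>. \<lambda>x\<in>carrier G. \<phi> x \<otimes>\<^bsub>circle_group\<^esub> \<psi> x),
      one = (\<lambda>x\<in>carrier G. \<one>\<^bsub>circle_group\<^esub>)\<rparr>"

text \<open>The compact-open topology; the choice \<open>K = {}\<close> gives the whole carrier.\<close>

definition dual_topology :: "'a monoid \<Rightarrow> 'a topology \<Rightarrow> ('a \<Rightarrow> real set) topology" where
  "dual_topology G T =
     topology_generated_by
       {{\<phi> \<in> carrier (dual_group G T). \<phi> ` K \<subseteq> U} | K U.
          compactin T K \<and> openin circle_topology U}"

definition reflexive_group :: "'a monoid \<Rightarrow> 'a topology \<Rightarrow> bool" where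
  "reflexive_group G T \<longleftrightarrow>
     top_isomorphic
       (dual_group (dual_group G T) (dual_topology G T))
       (dual_topology (dual_group G T) (dual_topology G T))
       G T"

definition int_power_group :: "'i set \<Rightarrow> ('i \<Rightarrow> int) monoid" where
  "int_power_group I = product_group I (\<lambda>_. integer_group)"

definition int_power_topology :: "'i set \<Rightarrow> ('i \<Rightarrow> int) topology" where
  "int_power_topology I = product_topology (\<lambda>_. discrete_topology UNIV) I"

end

theory Submission
  imports Defs "HOL-Library.Function_Algebras"
begin

text \<open>
  Let \<open>P\<close> be the group of all integer sequences and let \<open>H = Hom(P, \<int>)\<close> carry the topology of
  pointwise convergence on \<open>P\<close>. This is a closed subgroup of \<open>\<int>\<^sup>P\<close>, and \<open>P\<close> has the cardinality of
  the continuum. By Specker's theorem each \<open>h \<in> H\<close> is a finite integer combination of coordinate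
  projections, so \<open>H\<close> is countable. It is not discrete, because any finitely many
  sequences are annihilated by a nonzero \<open>h\<close>. On the other hand a gliding hump argument shows that
  every compact subset of \<open>H\<close> involves only finitely many coordinates. Hence every neighbourhood of the
  trivial character in the dual group contains all characters that are trivial on the first \<open>n\<close>
  projections, for some \<open>n\<close>. In particular the circles of characters \<open>h \<mapsto> r * h(e\<^sub>m) mod 1\<close>, one for
  each \<open>m\<close>, converge to the trivial character, and their union is compact. A continuous character of
  the dual group that maps this union into an arc without nontrivial subgroups is trivial. So
  the bidual is discrete and cannot be homeomorphic to \<open>H\<close>.
\<close>

subsection \<open>Homomorphisms from the Baer-Specker group to the integers\<close>

definition unit_seq :: "nat \<Rightarrow> nat \<Rightarrow> int" where
  "unit_seq n = (\<lambda>j. if j = n then 1 else 0)"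

lemma additive_scale:
  fixes h :: "('a \<Rightarrow> int) \<Rightarrow> int"
  assumes "Modules.additive h"
  shows "h (\<lambda>j. c * x j) = c * h x"
proof -
  interpret Modules.additive h by fact
  have step: "h (\<lambda>j. y j + x j) = h y + h x" "h (\<lambda>j. y j - x j) = h y - h x" for y
    using add[of y x] diff[of y x] by (simp_all add: plus_fun_def fun_diff_def)
  have "h (\<lambda>j. 0) = 0"
    using zero by (simp add: zero_fun_def)
  then show ?thesis
    by (induction c rule: int_induct[where k = 0]) (simp_all add: step distrib_right left_diff_distrib)
qed

lemma additive_truncate:
  fixes h :: "(nat \<Rightarrow> int) \<Rightarrow> int"
  assumes "Modules.additive h"
  shows "h (\<lambda>j. if j < n then x j else 0) = (\<Sum>j<n. x j * h (unit_seq j))"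
proof (induction n)
  case 0
  show ?case
    using Modules.additive.zero[OF assms] by (simp add: zero_fun_def)
next
  case (Suc n)
  have "(\<lambda>j. if j < Suc n then x j else 0) =
      (\<lambda>j. if j < n then x j else 0) + (\<lambda>j. x n * unit_seq n j)"
    by (auto simp: fun_eq_iff unit_seq_def less_Suc_eq)
  then show ?case
    by (simp only: Suc Modules.additive.add[OF assms] additive_scale[OF assms] sum.lessThan_Suc)
qed

text \<open>From index \<open>n\<close> on, \<open>x\<close> is \<open>c\<close> times another
  sequence, so its tail contributes a multiple of \<open>c\<close>; the head contributes the finite
  sum by \<open>additive_truncate\<close>.\<close>

lemma additive_dvd_tail:
  fixes h :: "(nat \<Rightarrow> int) \<Rightarrow> int"
  assumes "Modules.additive h" and "\<And>j. j \<ge> n \<Longrightarrow> c dvd x j"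
  shows "c dvd h x - (\<Sum>j<n. x j * h (unit_seq j))"
proof -
  define y where "y = (\<lambda>j. if j < n then 0 else x j div c)"
  have "x = (\<lambda>j. if j < n then x j else 0) + (\<lambda>j. c * y j)"
    using assms(2) by (auto simp: fun_eq_iff y_def)
  then have "h x = (\<Sum>j<n. x j * h (unit_seq j)) + c * h y"
    by (metis Modules.additive.add[OF assms(1)] additive_scale[OF assms(1)] additive_truncate[OF assms(1)])
  then show ?thesis
    by simp
qed

lemma eq_0_if_all_powers_dvd:
  fixes a p :: int
  assumes "p \<ge> 2" "\<And>n. p ^ n dvd a"
  shows "a = 0"
proof (rule ccontr)
  assume "a \<noteq> 0"
  obtain n where n: "nat \<bar>a\<bar> < 2 ^ n"
    using less_exp by blast
  have "\<bar>a\<bar> < 2 ^ n"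
    using n by (simp add: nat_less_iff)
  also have "(2::int) ^ n \<le> p ^ n"
    using assms(1) by (intro power_mono) auto
  finally show False
    using zdvd_imp_le[of "p ^ n" "\<bar>a\<bar>"] assms(2)[of n] \<open>a \<noteq> 0\<close> by simp
qed

text \<open>Since \<open>2 ^ n\<close> and \<open>3 ^ n\<close> are coprime, every sequence is the sum of one whose \<open>n\<close>-th entry
  is divisible by \<open>2 ^ n\<close> and one whose \<open>n\<close>-th entry is divisible by \<open>3 ^ n\<close>.\<close>

lemma additive_eq_0:
  fixes h :: "(nat \<Rightarrow> int) \<Rightarrow> int"
  assumes h: "Modules.additive h" and unit: "\<And>j. h (unit_seq j) = 0"
  shows "h x = 0"
proof -
  \<comment> \<open>Removing the first \<open>n\<close> entries costs nothing because
    \<open>h\<close> kills the unit sequences, and what remains is divisible by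
    \<open>p ^ n\<close>; this holds for every \<open>n\<close>.\<close>
  have *: "h (\<lambda>j. p ^ j * y j) = 0" if "p \<ge> 2" for p y
  proof (rule eq_0_if_all_powers_dvd[OF that])
    fix n
    have "p ^ n dvd p ^ j * y j" if "n \<le> j" for j
      using that by (simp add: le_imp_power_dvd)
    from additive_dvd_tail[OF h this] show "p ^ n dvd h (\<lambda>j. p ^ j * y j)"
      by (simp add: unit)
  qed
  have "\<exists>a b. x j = 2 ^ j * a + 3 ^ j * b" for j
  proof -
    have "coprime ((2::int) ^ j) (3 ^ j)"
      by simp
    then obtain u v where "u * 2 ^ j + v * 3 ^ j = (1::int)"
      using bezout_int[of "2 ^ j" "3 ^ j"] by auto
    then have "x j = (u * 2 ^ j + v * 3 ^ j) * x j"
      by simp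
    also have "\<dots> = 2 ^ j * (u * x j) + 3 ^ j * (v * x j)"
      by (simp add: algebra_simps)
    finally show ?thesis
      by blast
  qed
  then obtain a b where "\<And>j. x j = 2 ^ j * a j + 3 ^ j * b j"
    by metis
  then have "x = (\<lambda>j. 2 ^ j * a j) + (\<lambda>j. 3 ^ j * b j)"
    by (auto simp: fun_eq_iff)
  then show ?thesis
    using Modules.additive.add[OF h] *[of 2 a] *[of 3 b] by simp
qed

text \<open>The exponents \<open>m j\<close> grow so fast that \<open>h\<close> separates the sequences \<open>x A\<close>: modulo
  \<open>2 ^ m (Suc j)\<close>, the values at \<open>x A\<close> and \<open>x B\<close> differ by \<open>2 ^ m j * h (unit_seq j)\<close>
  if \<open>j\<close> is the first place where \<open>A\<close> and \<open>B\<close> differ.\<close>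

lemma finite_additive_support:
  fixes h :: "(nat \<Rightarrow> int) \<Rightarrow> int"
  assumes h: "Modules.additive h"
  shows "finite {j. h (unit_seq j) \<noteq> 0}"
proof (rule ccontr)
  define S where "S = {j. h (unit_seq j) \<noteq> 0}"
  assume "infinite {j. h (unit_seq j) \<noteq> 0}"
  then have inf: "infinite S"
    by (simp add: S_def)
  \<comment> \<open>The increment from \<open>m j\<close> to \<open>m (Suc j)\<close> is the
    absolute value of \<open>h (unit_seq j)\<close>. As \<open>2 ^ k > k\<close>, a nonzero
    \<open>h (unit_seq j)\<close> is not divisible by 2 to that increment.\<close>
  define m where "m = (\<lambda>n. \<Sum>j<n. nat \<bar>h (unit_seq j)\<bar>)"
  have m_mono: "m i \<le> m j" if "i \<le> j" for i j
    unfolding m_def using that by (intro sum_mono2) auto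
  define x where "x = (\<lambda>A j. if j \<in> A then 2 ^ m j else 0 :: int)"
  have key: "h (x A) \<noteq> h (x B)"
    if j: "j \<in> A" "j \<notin> B" "j \<in> S" and eq: "\<And>i. i < j \<Longrightarrow> i \<in> A \<longleftrightarrow> i \<in> B" for A B j
  proof
    assume hAB: "h (x A) = h (x B)"
    have dv: "(2::int) ^ m (Suc j) dvd h (x C) - (\<Sum>i<Suc j. x C i * h (unit_seq i))" for C
    proof (rule additive_dvd_tail[OF h])
      show "(2::int) ^ m (Suc j) dvd x C i" if "Suc j \<le> i" for i
        using m_mono[OF that] by (simp add: x_def le_imp_power_dvd)
    qed
    have "(\<Sum>i<j. x A i * h (unit_seq i)) = (\<Sum>i<j. x B i * h (unit_seq i))"
      using eq by (intro sum.cong) (auto simp: x_def)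
    then have "(\<Sum>i<Suc j. x A i * h (unit_seq i)) - (\<Sum>i<Suc j. x B i * h (unit_seq i))
        = 2 ^ m j * h (unit_seq j)"
      using j by (simp add: x_def)
    moreover have "(2::int) ^ m (Suc j) dvd
        (h (x B) - (\<Sum>i<Suc j. x B i * h (unit_seq i))) - (h (x A) - (\<Sum>i<Suc j. x A i * h (unit_seq i)))"
      by (rule dvd_diff[OF dv dv])
    ultimately have "(2::int) ^ m (Suc j) dvd 2 ^ m j * h (unit_seq j)"
      using hAB by (simp only: diff_diff_eq2 diff_add_cancel add_diff_cancel)
        (smt (verit))
    then have "(2::int) ^ nat \<bar>h (unit_seq j)\<bar> dvd h (unit_seq j)"
      by (simp add: m_def power_add)
    then have "(2::int) ^ nat \<bar>h (unit_seq j)\<bar> \<le> \<bar>h (unit_seq j)\<bar>"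
      using zdvd_imp_le[of _ "\<bar>h (unit_seq j)\<bar>"] j(3) by (simp add: S_def)
    moreover have "int (nat \<bar>h (unit_seq j)\<bar>) < int (2 ^ nat \<bar>h (unit_seq j)\<bar>)"
      using less_exp by (simp only: of_nat_less_iff)
    ultimately show False
      by simp
  qed
  have "inj_on (\<lambda>A. h (x A)) (Pow S)"
  proof (rule inj_onI, rule ccontr)
    fix A B
    assume AB: "A \<in> Pow S" "B \<in> Pow S" "h (x A) = h (x B)" "A \<noteq> B"
    define j where "j = (LEAST j. (j \<in> A) \<noteq> (j \<in> B))"
    obtain i where "(i \<in> A) \<noteq> (i \<in> B)"
      using AB(4) by blast
    then have "(j \<in> A) \<noteq> (j \<in> B)"
      unfolding j_def by (rule LeastI[where P = "\<lambda>j. (j \<in> A) \<noteq> (j \<in> B)"])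
    moreover have "(i \<in> A) = (i \<in> B)" if "i < j" for i
      using not_less_Least[of i "\<lambda>j. (j \<in> A) \<noteq> (j \<in> B)"] that unfolding j_def by blast
    ultimately show False
      using key[of j A B] key[of j B A] AB(1,2) AB(3)[symmetric] AB(3) by blast
  qed
  \<comment> \<open>An injection of \<open>Pow S\<close> into the integers makes it no larger than
    the infinite set \<open>S\<close>, against Cantor.\<close>
  then have "countable (Pow S)"
    by (rule countableI')
  then have "Pow S \<lesssim> (UNIV :: nat set)"
    unfolding countable_def lepoll_def by auto
  also have "(UNIV :: nat set) \<lesssim> S"
    using inf by (simp add: infinite_le_lepoll)
  finally show False
    using lesspoll_Pow_self[of S] lepoll_antisym lepoll_Pow_self unfolding lesspoll_def by blast
qed

text \<open>The difference of the two sides is additive and kills every unit sequence, so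
  \<open>additive_eq_0\<close> applies.\<close>

lemma additive_eq_sum:
  fixes h :: "(nat \<Rightarrow> int) \<Rightarrow> int"
  assumes h: "Modules.additive h" and n: "\<And>j. n \<le> j \<Longrightarrow> h (unit_seq j) = 0"
  shows "h x = (\<Sum>j<n. x j * h (unit_seq j))"
proof -
  define f where "f = (\<lambda>x. h x - (\<Sum>j<n. x j * h (unit_seq j)))"
  have "Modules.additive f"
    by unfold_locales
      (simp add: f_def Modules.additive.add[OF h] sum.distrib algebra_simps)
  moreover have "f (unit_seq i) = 0" for i
    using n[of i] unfolding f_def
    by (cases "i < n") (auto simp: unit_seq_def if_distrib[of "\<lambda>x. x * _"] cong: if_cong)
  ultimately have "f x = 0"
    by (rule additive_eq_0)
  then show ?thesis
    by (simp add: f_def)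
qed

text \<open>This is Specker's theorem; \<open>n\<close> is any bound on the finite support.\<close>

lemma additive_finite_rank:
  fixes h :: "(nat \<Rightarrow> int) \<Rightarrow> int"
  assumes "Modules.additive h"
  obtains n where "\<And>j. n \<le> j \<Longrightarrow> h (unit_seq j) = 0" "\<And>x. h x = (\<Sum>j<n. x j * h (unit_seq j))"
proof -
  obtain n where "\<And>j. h (unit_seq j) \<noteq> 0 \<Longrightarrow> j < n"
    using finite_additive_support[OF assms] unfolding finite_nat_set_iff_bounded by auto
  then have n: "\<And>j. n \<le> j \<Longrightarrow> h (unit_seq j) = 0"
    by (meson linorder_not_less)
  with additive_eq_sum[OF assms n] show thesis
    using that by blast
qed

text \<open>Gliding hump: \<open>x\<close> is chosen recursively, with \<open>x j\<close> so large that the functional whose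
  last nonzero coefficient is the \<open>j\<close>-th one takes a value of size at least \<open>j\<close> at \<open>x\<close>.\<close>

lemma pointwise_finite_imp_bounded_support:
  fixes A :: "((nat \<Rightarrow> int) \<Rightarrow> int) set"
  assumes add: "\<And>h. h \<in> A \<Longrightarrow> Modules.additive h" and fin: "\<And>x. finite ((\<lambda>h. h x) ` A)"
  shows "\<exists>n. \<forall>h\<in>A. \<forall>j\<ge>n. h (unit_seq j) = 0"
proof (rule ccontr)
  assume unbounded: "\<not> ?thesis"
  \<comment> \<open>\<open>top h j\<close> makes \<open>j\<close> the last nonzero index of
    \<open>h\<close>. One representative \<open>c j\<close> per possible last index suffices; where
    none exists, \<open>c j\<close> is arbitrary, so the requirements on \<open>x\<close> are
    guarded by \<open>top h j\<close>.\<close>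
  define top where "top = (\<lambda>h j. h \<in> A \<and> h (unit_seq j) \<noteq> 0 \<and> (\<forall>i>j. h (unit_seq i) = 0))"
  define c where "c = (\<lambda>j. SOME h. top h j)"
  have top_c: "top (c j) j" if "top h j" for h j
    unfolding c_def using that by (rule someI[where P = "\<lambda>h. top h j"])
  have "\<exists>x. \<forall>j. \<forall>h. top h j \<longrightarrow> int j \<le> \<bar>(\<Sum>i<j. x i * c j (unit_seq i)) + x j * c j (unit_seq j)\<bar>"
  proof (rule dependent_wf_choice[OF wf_less, where
        P = "\<lambda>x j v. \<forall>h. top h j \<longrightarrow> int j \<le> \<bar>(\<Sum>i<j. x i * c j (unit_seq i)) + v * c j (unit_seq j)\<bar>"])
    fix x :: "nat \<Rightarrow> int" and j
    define s where "s = (\<Sum>i<j. x i * c j (unit_seq i))"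
    \<comment> \<open>The entry \<open>\<bar>s\<bar> + int j\<close> works because the last
      coefficient is a nonzero integer: the new term has size at least
      \<open>\<bar>s\<bar> + int j\<close>, and the earlier sum \<open>s\<close> can cancel at most
      \<open>\<bar>s\<bar>\<close> of it.\<close>
    have "int j \<le> \<bar>s + (\<bar>s\<bar> + int j) * c j (unit_seq j)\<bar>" if "top h j" for h
    proof -
      have "c j (unit_seq j) \<noteq> 0"
        using top_c[OF that] by (simp add: top_def)
      then have "1 \<le> \<bar>c j (unit_seq j)\<bar>"
        by linarith
      then have "(\<bar>s\<bar> + int j) * 1 \<le> (\<bar>s\<bar> + int j) * \<bar>c j (unit_seq j)\<bar>"
        by (intro mult_left_mono) auto
      also have "\<dots> = \<bar>(\<bar>s\<bar> + int j) * c j (unit_seq j)\<bar>"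
        by (simp add: abs_mult)
      also have "\<dots> \<le> \<bar>s + (\<bar>s\<bar> + int j) * c j (unit_seq j)\<bar> + \<bar>s\<bar>"
        using abs_triangle_ineq4[of "s + (\<bar>s\<bar> + int j) * c j (unit_seq j)" s] by simp
      finally show ?thesis
        by simp
    qed
    then show "\<exists>v. \<forall>h. top h j \<longrightarrow>
        int j \<le> \<bar>(\<Sum>i<j. x i * c j (unit_seq i)) + v * c j (unit_seq j)\<bar>"
      unfolding s_def by blast
  next
    fix f g :: "nat \<Rightarrow> int" and j v
    assume "\<And>i. (i, j) \<in> {(x, y). x < y} \<Longrightarrow> f i = g i"
    then have "(\<Sum>i<j. f i * c j (unit_seq i)) = (\<Sum>i<j. g i * c j (unit_seq i))"
      by (intro sum.cong) auto
    then show "(\<forall>h. top h j \<longrightarrow> int j \<le> \<bar>(\<Sum>i<j. f i * c j (unit_seq i)) + v * c j (unit_seq j)\<bar>) =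
        (\<forall>h. top h j \<longrightarrow> int j \<le> \<bar>(\<Sum>i<j. g i * c j (unit_seq i)) + v * c j (unit_seq j)\<bar>)"
      by simp
  qed
  then obtain x where x: "\<And>j h. top h j \<Longrightarrow>
      int j \<le> \<bar>(\<Sum>i<j. x i * c j (unit_seq i)) + x j * c j (unit_seq j)\<bar>"
    by blast
  obtain N where N: "\<And>h. h \<in> A \<Longrightarrow> \<bar>h x\<bar> < int N"
  proof -
    have "finite ((\<lambda>h. nat \<bar>h x\<bar>) ` A)"
      using finite_imageI[OF fin[of x], of "\<lambda>k. nat \<bar>k\<bar>"] by (simp add: image_image)
    then obtain N where "\<forall>k\<in>(\<lambda>h. nat \<bar>h x\<bar>) ` A. k < N"
      using finite_nat_set_iff_bounded by auto
    then show thesis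
      by (intro that[of N]) (auto simp: nat_less_iff)
  qed
  \<comment> \<open>A nonzero coefficient beyond \<open>N\<close> puts the last nonzero index
    \<open>k\<close> beyond \<open>N\<close> too, so the representative \<open>c k\<close> violates
    the bound at \<open>x\<close>.\<close>
  obtain h j where hj: "h \<in> A" "N \<le> j" "h (unit_seq j) \<noteq> 0"
    using unbounded by blast
  define k where "k = Max {i. h (unit_seq i) \<noteq> 0}"
  have supp: "finite {i. h (unit_seq i) \<noteq> 0}"
    using finite_additive_support add hj(1) by blast
  have "top h k"
    unfolding top_def
  proof (intro conjI allI impI)
    show "h (unit_seq k) \<noteq> 0"
      using Max_in[OF supp] hj(3) unfolding k_def by auto
    show "h (unit_seq i) = 0" if "i > k" for i
      using Max_ge[OF supp, of i] that unfolding k_def by fastforce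
  qed (use hj in auto)
  have "N \<le> k"
    using Max_ge[OF supp, of j] hj unfolding k_def by simp
  have ck: "c k \<in> A" "\<And>i. i \<ge> Suc k \<Longrightarrow> c k (unit_seq i) = 0"
    using top_c[OF \<open>top h k\<close>] by (auto simp: top_def)
  have "int k \<le> \<bar>c k x\<bar>"
    using x[OF \<open>top h k\<close>] additive_eq_sum[of "c k" "Suc k" x] add ck by simp
  then show False
    using N[OF ck(1)] \<open>N \<le> k\<close> by linarith
qed

text \<open>The prescribed block of leading zeros drives the induction: it yields a second
  functional \<open>g\<close> with no coefficient up to \<open>m\<close>, and hence independent of
  \<open>f\<close>.\<close>

lemma additive_vanishing_on_finite:
  fixes F :: "(nat \<Rightarrow> int) set"
  assumes "finite F"
  shows "\<exists>h m. Modules.additive h \<and> n \<le> m \<and> h (unit_seq m) \<noteq> (0::int) \<and> (\<forall>j<n. h (unit_seq j) = 0) \<and>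
    (\<forall>x\<in>F. h x = 0)"
  using assms
proof (induction F arbitrary: n)
  case empty
  have "Modules.additive (\<lambda>x. x n :: int)"
    by unfold_locales simp
  then show ?case
    by (intro exI[of _ "\<lambda>x. x n"] exI[of _ n]) (auto simp: unit_seq_def)
next
  case (insert y F)
  obtain f m where "Modules.additive f \<and> n \<le> m \<and> f (unit_seq m) \<noteq> (0::int) \<and>
      (\<forall>j<n. f (unit_seq j) = 0) \<and> (\<forall>x\<in>F. f x = 0)"
    using insert.IH[of n] by (elim exE) (rule that)
  then have f: "Modules.additive f" "n \<le> m" "f (unit_seq m) \<noteq> 0" "\<forall>j<n. f (unit_seq j) = 0"
      "\<forall>x\<in>F. f x = 0"
    by simp_all
  obtain g k where "Modules.additive g \<and> Suc m \<le> k \<and> g (unit_seq k) \<noteq> (0::int) \<and>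
      (\<forall>j<Suc m. g (unit_seq j) = 0) \<and> (\<forall>x\<in>F. g x = 0)"
    using insert.IH[of "Suc m"] by (elim exE) (rule that)
  then have g: "Modules.additive g" "Suc m \<le> k" "g (unit_seq k) \<noteq> 0"
      "\<forall>j<Suc m. g (unit_seq j) = 0" "\<forall>x\<in>F. g x = 0"
    by simp_all
  show ?case
  proof (cases "g y = 0")
    case True
    then show ?thesis
      using f(2) g by (intro exI[of _ g] exI[of _ k]) auto
  next
    case False
    \<comment> \<open>This combination cancels at \<open>y\<close>. Since \<open>g\<close> vanishes
      at \<open>unit_seq m\<close>, its coefficient there is \<open>g y * f (unit_seq m)\<close>,
      which is nonzero.\<close>
    have "Modules.additive (\<lambda>x. g y * f x - f y * g x)"
      using f(1) g(1) by (simp add: Modules.additive_def algebra_simps)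
    then show ?thesis
      using f g False by (intro exI[of _ "\<lambda>x. g y * f x - f y * g x"] exI[of _ m]) auto
  qed
qed

text \<open>A sequence is coded by its graph, a subset of a countable set, so there are at most
  continuum many sequences.\<close>

lemma surj_onto_int_sequences:
  assumes "I \<approx> (UNIV :: real set)"
  shows "\<exists>b. b ` I = (UNIV :: (nat \<Rightarrow> int) set)"
proof -
  have "inj (\<lambda>x::nat \<Rightarrow> int. to_nat ` range (\<lambda>n. (n, x n)))"
  proof (rule injI)
    fix x y :: "nat \<Rightarrow> int"
    assume "to_nat ` range (\<lambda>n. (n, x n)) = to_nat ` range (\<lambda>n. (n, y n))"
    then have "range (\<lambda>n. (n, x n)) = range (\<lambda>n. (n, y n))"
      by (simp only: inj_image_eq_iff[OF inj_to_nat])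
    then show "x = y"
      by (auto simp: fun_eq_iff set_eq_iff)
  qed
  then have "(UNIV :: (nat \<Rightarrow> int) set) \<lesssim> (UNIV :: nat set set)"
    unfolding lepoll_def by blast
  also have "(UNIV :: nat set set) \<approx> (UNIV :: real set)"
    by (rule nat_sets_eqpoll_reals)
  also have "(UNIV :: real set) \<approx> I"
    using assms by (rule eqpoll_sym)
  finally show ?thesis
    unfolding lepoll_iff by auto
qed

subsection \<open>The circle group\<close>

definition circle_of :: "real \<Rightarrow> real set" where
  "circle_of x = \<int> #>\<^bsub>real_group\<^esub> x"

lemma comm_group_real_group: "comm_group real_group"
  by (rule comm_groupI) (auto simp: real_group_def intro: exI[of _ "- _"] bexI[of _ "- _"])

lemma subgroup_Ints_real_group: "subgroup \<int> real_group"
proof (rule group.subgroupI)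
  show "group real_group"
    using comm_group_real_group by (rule comm_group.axioms(2))
  show "inv\<^bsub>real_group\<^esub> a \<in> \<int>" if "a \<in> \<int>" for a
  proof -
    have "inv\<^bsub>real_group\<^esub> a = - a"
      by (rule group.inv_equality[OF comm_group.axioms(2)[OF comm_group_real_group]])
        (simp_all add: real_group_def)
    then show ?thesis
      using that by simp
  qed
qed (auto simp: real_group_def)

interpretation circle: comm_group circle_group
  unfolding circle_group_def
  by (rule comm_group.abelian_FactGroup[OF comm_group_real_group subgroup_Ints_real_group])

lemma circle_of_altdef: "circle_of x = {k + x | k. k \<in> \<int>}"
  by (auto simp: circle_of_def r_coset_def real_group_def)

lemma circle_of_eq_iff: "circle_of x = circle_of y \<longleftrightarrow> x - y \<in> \<int>"
proof
  assume "circle_of x = circle_of y"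
  moreover have "x \<in> circle_of x"
    by (auto simp: circle_of_altdef intro!: exI[of _ 0])
  ultimately show "x - y \<in> \<int>"
    by (auto simp: circle_of_altdef)
next
  assume xy: "x - y \<in> \<int>"
  have "k + x = (k + (x - y)) + y" "k + y = (k - (x - y)) + x" for k
    by simp_all
  then show "circle_of x = circle_of y"
    unfolding circle_of_altdef using xy Ints_add Ints_diff by blast
qed

lemma carrier_circle_group: "carrier circle_group = range circle_of"
  by (auto simp: circle_group_def carrier_FactGroup circle_of_def real_group_def)

lemma circle_of_closed [simp]: "circle_of x \<in> carrier circle_group"
  by (simp add: carrier_circle_group)

lemma circle_of_add: "circle_of (x + y) = circle_of x \<otimes>\<^bsub>circle_group\<^esub> circle_of y"
proof -
  have "k + l + (x + y) = (k + x) + (l + y)" "k + (x + y) = (k + x) + (0 + y)" for k l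
    by simp_all
  then show ?thesis
    unfolding circle_group_def mult_FactGroup set_mult_def circle_of_altdef
    by (auto simp: real_group_def)
qed

lemma circle_of_0: "circle_of 0 = \<one>\<^bsub>circle_group\<^esub>"
  by (auto simp: circle_group_def circle_of_altdef)

text \<open>The projection from the line is open, because the saturation of \<open>V\<close> is the
  union of its integer translates.\<close>

lemma openin_circle_of_image:
  assumes "open V"
  shows "openin circle_topology (circle_of ` V)"
proof -
  have "{x. circle_of x \<in> circle_of ` V} = (\<Union>k\<in>\<int>. (\<lambda>x. k + x) ` V)"
  proof (intro Set.set_eqI iffI)
    fix x assume "x \<in> {x. circle_of x \<in> circle_of ` V}"
    then obtain v where "v \<in> V" "x - v \<in> \<int>"
      by (auto simp: circle_of_eq_iff)
    then show "x \<in> (\<Union>k\<in>\<int>. (\<lambda>x. k + x) ` V)"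
      by (auto intro!: bexI[of _ "x - v"] image_eqI[of _ _ v])
  next
    fix x assume "x \<in> (\<Union>k\<in>\<int>. (\<lambda>x. k + x) ` V)"
    then obtain k v where "k \<in> \<int>" "v \<in> V" "x = k + v"
      by auto
    then show "x \<in> {x. circle_of x \<in> circle_of ` V}"
      using circle_of_eq_iff[of x v] by auto
  qed
  then have "open {x. circle_of x \<in> circle_of ` V}"
    using assms by (auto intro!: open_UN open_translation)
  then show ?thesis
    by (auto simp: openin_circle_topology circle_of_def[symmetric])
qed

lemma continuous_map_circle_mult:
  assumes f: "continuous_map X circle_topology f" and g: "continuous_map X circle_topology g"
  shows "continuous_map X circle_topology (\<lambda>x. f x \<otimes>\<^bsub>circle_group\<^esub> g x)"
  unfolding continuous_map_def
proof (intro conjI allI impI)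
  have fc: "f x \<in> carrier circle_group" and gc: "g x \<in> carrier circle_group" if "x \<in> topspace X" for x
    using continuous_map_image_subset_topspace[OF f] continuous_map_image_subset_topspace[OF g] that
    by auto
  show "(\<lambda>x. f x \<otimes>\<^bsub>circle_group\<^esub> g x) \<in> topspace X \<rightarrow> topspace circle_topology"
    using fc gc by auto
  fix U assume U: "openin circle_topology U"
  then have oU: "open {x. circle_of x \<in> U}"
    by (simp add: openin_circle_topology circle_of_def)
  show "openin X {x \<in> topspace X. f x \<otimes>\<^bsub>circle_group\<^esub> g x \<in> U}"
  proof (subst openin_subopen, intro ballI)
    fix x assume "x \<in> {x \<in> topspace X. f x \<otimes>\<^bsub>circle_group\<^esub> g x \<in> U}"
    then have x: "x \<in> topspace X" "f x \<otimes>\<^bsub>circle_group\<^esub> g x \<in> U"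
      by auto
    obtain s t where st: "f x = circle_of s" "g x = circle_of t"
      using fc[OF x(1)] gc[OF x(1)] by (auto simp: carrier_circle_group)
    \<comment> \<open>Continuity is transferred from addition of reals: a product neighbourhood of
      the lifts \<open>s\<close> and \<open>t\<close> is pushed down by the open projection.\<close>
    then have "(s, t) \<in> (\<lambda>(s, t). s + t) -` {x. circle_of x \<in> U}"
      using x(2) by (simp add: circle_of_add)
    moreover have "open ((\<lambda>(s, t). s + t) -` {x. circle_of x \<in> U})"
      by (intro open_vimage oU) (simp add: case_prod_unfold continuous_intros)
    moreover note open_prod_elim[of "(\<lambda>(s, t). s + t) -` {x. circle_of x \<in> U}" "(s, t)"]
    ultimately obtain A B where AB: "open A" "open B" "(s, t) \<in> A \<times> B"
        "A \<times> B \<subseteq> (\<lambda>(s, t). s + t) -` {x. circle_of x \<in> U}"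
      by metis
    define W where "W = {x \<in> topspace X. f x \<in> circle_of ` A} \<inter> {x \<in> topspace X. g x \<in> circle_of ` B}"
    have "openin X W"
      unfolding W_def using AB(1,2)
      by (intro openin_Int openin_continuous_map_preimage[OF f] openin_continuous_map_preimage[OF g]
          openin_circle_of_image)
    moreover have "x \<in> W"
      using x(1) st AB(3) by (auto simp: W_def)
    moreover have "W \<subseteq> {x \<in> topspace X. f x \<otimes>\<^bsub>circle_group\<^esub> g x \<in> U}"
      using AB(4) by (fastforce simp: W_def circle_of_add[symmetric])
    ultimately show "\<exists>T. openin X T \<and> x \<in> T \<and> T \<subseteq> {x \<in> topspace X. f x \<otimes>\<^bsub>circle_group\<^esub> g x \<in> U}"
      by blast
  qed
qed

definition small_arc :: "real set set" where
  "small_arc = circle_of ` {-1/4<..<1/4}"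

lemma openin_small_arc: "openin circle_topology small_arc"
  unfolding small_arc_def by (rule openin_circle_of_image) simp

lemma one_in_small_arc: "\<one>\<^bsub>circle_group\<^esub> \<in> small_arc"
  unfolding small_arc_def circle_of_0[symmetric] by (rule imageI) simp

text \<open>The lifts \<open>k * x\<close> never leave the interval of radius 1/4: one step moves by
  less than 1/4, too little to reach another integer translate of that interval. Bounded multiples
  force \<open>x = 0\<close>.\<close>

lemma small_arc_no_subgroup:
  assumes z: "z \<in> carrier circle_group" and pow: "\<And>k::nat. z [^]\<^bsub>circle_group\<^esub> k \<in> small_arc"
  shows "z = \<one>\<^bsub>circle_group\<^esub>"
proof -
  have arcE: "\<exists>y. \<bar>y\<bar> < 1/4 \<and> w = circle_of y" if w: "w \<in> small_arc" for w
  proof -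
    obtain y where "y \<in> {-1/4<..<1/4}" "w = circle_of y"
      using w unfolding small_arc_def by blast
    then show ?thesis
      by (intro exI[of _ y]) (auto simp: abs_less_iff)
  qed
  obtain x where x: "\<bar>x\<bar> < 1/4" "z = circle_of x"
    using arcE[of z] pow[of 1] z by auto
  have multiple: "z [^]\<^bsub>circle_group\<^esub> k = circle_of (real k * x)" for k :: nat
    by (induction k) (auto simp: circle_of_0 x(2) circle_of_add[symmetric] algebra_simps)
  have "\<bar>real k * x\<bar> < 1/4" for k
  proof (induction k)
    case (Suc k)
    have "\<bar>real (Suc k) * x\<bar> \<le> \<bar>real k * x\<bar> + \<bar>x\<bar>"
      using abs_triangle_ineq[of "real k * x" x] by (simp add: algebra_simps)
    then have lt: "\<bar>real (Suc k) * x\<bar> < 1/2"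
      using Suc x(1) by linarith
    obtain y where y: "\<bar>y\<bar> < 1/4" "circle_of (real (Suc k) * x) = circle_of y"
      using arcE[OF pow[of "Suc k"]] unfolding multiple by auto
    then obtain m where m: "real (Suc k) * x - y = of_int m"
      by (auto simp: circle_of_eq_iff elim: Ints_cases)
    then have "\<bar>real_of_int m\<bar> < 1"
      using lt y(1) by linarith
    then have "m = 0"
      by linarith
    then show ?case
      using m y(1) by simp
  qed simp
  then have "x = 0"
    using reals_Archimedean3[of "\<bar>x\<bar>"] by (metis abs_mult abs_of_nat less_asym' zero_less_abs_iff)
  then show ?thesis
    by (simp add: x(2) circle_of_0)
qed

subsection \<open>Dual groups\<close>

lemma dual_carrier_iff:
  "\<kappa> \<in> carrier (dual_group G T) \<longleftrightarrow>
     \<kappa> \<in> hom G circle_group \<and> \<kappa> \<in> extensional (carrier G) \<and> continuous_map T circle_topology \<kappa>"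
  by (simp add: dual_group_def)

lemma dual_mult_eq:
  "\<kappa> \<otimes>\<^bsub>dual_group G T\<^esub> \<psi> = (\<lambda>x\<in>carrier G. \<kappa> x \<otimes>\<^bsub>circle_group\<^esub> \<psi> x)"
  by (simp add: dual_group_def)

lemma dual_one_eq: "\<one>\<^bsub>dual_group G T\<^esub> = (\<lambda>x\<in>carrier G. \<one>\<^bsub>circle_group\<^esub>)"
  by (simp add: dual_group_def)

lemma dual_apply_closed:
  "\<kappa> \<in> carrier (dual_group G T) \<Longrightarrow> x \<in> carrier G \<Longrightarrow> \<kappa> x \<in> carrier circle_group"
  by (auto simp: dual_carrier_iff hom_def)

lemma dual_apply_mult:
  "\<kappa> \<in> carrier (dual_group G T) \<Longrightarrow> x \<in> carrier G \<Longrightarrow> y \<in> carrier G \<Longrightarrow>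
    \<kappa> (x \<otimes>\<^bsub>G\<^esub> y) = \<kappa> x \<otimes>\<^bsub>circle_group\<^esub> \<kappa> y"
  by (auto simp: dual_carrier_iff hom_def)

text \<open>Closure rests on the circle being commutative, which makes pointwise products of
  homomorphisms homomorphisms, and on the continuity of its multiplication.\<close>

lemma monoid_dual_group:
  assumes "monoid G" and T: "topspace T = carrier G"
  shows "monoid (dual_group G T)"
proof -
  interpret monoid G by fact
  show ?thesis
  proof (rule monoidI)
    fix \<kappa> \<psi> assume c: "\<kappa> \<in> carrier (dual_group G T)" "\<psi> \<in> carrier (dual_group G T)"
    have "continuous_map T circle_topology (\<lambda>x. \<kappa> x \<otimes>\<^bsub>circle_group\<^esub> \<psi> x)"
      using c by (intro continuous_map_circle_mult) (auto simp: dual_carrier_iff)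
    then have "continuous_map T circle_topology (\<kappa> \<otimes>\<^bsub>dual_group G T\<^esub> \<psi>)"
      by (rule continuous_map_eq) (simp add: dual_mult_eq T)
    moreover have "\<kappa> \<otimes>\<^bsub>dual_group G T\<^esub> \<psi> \<in> hom G circle_group"
      using dual_apply_closed[OF c(1)] dual_apply_closed[OF c(2)]
      by (intro homI)
        (auto simp: dual_mult_eq dual_apply_mult[OF c(1)] dual_apply_mult[OF c(2)] circle.m_ac)
    ultimately show "\<kappa> \<otimes>\<^bsub>dual_group G T\<^esub> \<psi> \<in> carrier (dual_group G T)"
      by (simp add: dual_carrier_iff) (simp add: dual_mult_eq)
  next
    have "continuous_map T circle_topology \<one>\<^bsub>dual_group G T\<^esub>"
      by (rule continuous_map_eq[of _ _ "\<lambda>_. \<one>\<^bsub>circle_group\<^esub>"]) (auto simp: dual_one_eq T)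
    then show "\<one>\<^bsub>dual_group G T\<^esub> \<in> carrier (dual_group G T)"
      by (auto simp: dual_carrier_iff dual_one_eq intro!: homI)
  next
    fix \<kappa> \<psi> \<theta>
    assume "\<kappa> \<in> carrier (dual_group G T)" "\<psi> \<in> carrier (dual_group G T)"
      "\<theta> \<in> carrier (dual_group G T)"
    then show "\<kappa> \<otimes>\<^bsub>dual_group G T\<^esub> \<psi> \<otimes>\<^bsub>dual_group G T\<^esub> \<theta> =
        \<kappa> \<otimes>\<^bsub>dual_group G T\<^esub> (\<psi> \<otimes>\<^bsub>dual_group G T\<^esub> \<theta>)"
      by (auto simp: dual_mult_eq circle.m_assoc dual_apply_closed intro!: restrict_ext)
  next
    fix \<kappa> assume c: "\<kappa> \<in> carrier (dual_group G T)"
    then have "\<kappa> \<in> extensional (carrier G)"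
      by (simp add: dual_carrier_iff)
    with c show "\<one>\<^bsub>dual_group G T\<^esub> \<otimes>\<^bsub>dual_group G T\<^esub> \<kappa> = \<kappa>"
        "\<kappa> \<otimes>\<^bsub>dual_group G T\<^esub> \<one>\<^bsub>dual_group G T\<^esub> = \<kappa>"
      by (auto simp: dual_mult_eq dual_one_eq dual_apply_closed intro!: extensionalityI[of _ "carrier G"])
  qed
qed

lemma openin_dual_topology_subbasis:
  assumes "compactin T K" "openin circle_topology U"
  shows "openin (dual_topology G T) {\<kappa> \<in> carrier (dual_group G T). \<kappa> ` K \<subseteq> U}"
  unfolding dual_topology_def by (rule topology_generated_by_Basis) (use assms in blast)

lemma topspace_dual_topology [simp]: "topspace (dual_topology G T) = carrier (dual_group G T)"
proof
  have "openin (dual_topology G T) {\<kappa> \<in> carrier (dual_group G T). \<kappa> ` {} \<subseteq> {}}"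
    by (rule openin_dual_topology_subbasis) auto
  from openin_subset[OF this] show "carrier (dual_group G T) \<subseteq> topspace (dual_topology G T)"
    by simp
qed (auto simp: dual_topology_def)

text \<open>It is enough to treat subbasic neighbourhoods: for a finite intersection the larger
  index serves, since \<open>N\<close> is decreasing, and unions are immediate.\<close>

lemma dual_topology_local_base:
  fixes N :: "nat \<Rightarrow> ('a \<Rightarrow> real set) set"
  assumes "openin (dual_topology G T) W" "\<kappa> \<in> W" and "antimono N"
    and base: "\<And>K U. compactin T K \<Longrightarrow> openin circle_topology U \<Longrightarrow> \<kappa> ` K \<subseteq> U \<Longrightarrow>
      \<exists>n. N n \<subseteq> {\<psi> \<in> carrier (dual_group G T). \<psi> ` K \<subseteq> U}"
  shows "\<exists>n. N n \<subseteq> W"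
proof -
  have "generate_topology_on {{\<phi> \<in> carrier (dual_group G T). \<phi> ` K \<subseteq> U} | K U.
          compactin T K \<and> openin circle_topology U} W"
    using assms(1) by (simp add: dual_topology_def openin_topology_generated_by_iff)
  then show ?thesis
    using \<open>\<kappa> \<in> W\<close>
  proof induction
    case (Int A B)
    then obtain m n where "N m \<subseteq> A" "N n \<subseteq> B"
      by auto
    moreover have "N (max m n) \<subseteq> N m" "N (max m n) \<subseteq> N n"
      using \<open>antimono N\<close> by (simp_all add: antimonoD)
    ultimately show ?case
      by blast
  next
    case (UN \<K>)
    then show ?case
      by (meson Union_iff Union_upper subset_trans)
  next
    case (Basis S)
    then show ?case
      using base by auto
  qed simp
qed

text \<open>All powers of \<open>x\<close> stay in \<open>Q\<close>, so all powers of its image stay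
  in the small arc.\<close>

lemma hom_trivial_if_small:
  assumes "monoid D" and \<phi>: "\<phi> \<in> hom D circle_group"
    and Q: "Q \<subseteq> carrier D" "\<one>\<^bsub>D\<^esub> \<in> Q" "\<And>x y. x \<in> Q \<Longrightarrow> y \<in> Q \<Longrightarrow> x \<otimes>\<^bsub>D\<^esub> y \<in> Q"
    and small: "\<phi> ` Q \<subseteq> small_arc" and x: "x \<in> Q"
  shows "\<phi> x = \<one>\<^bsub>circle_group\<^esub>"
proof (rule small_arc_no_subgroup)
  interpret D: monoid D by fact
  have mult: "\<phi> (y \<otimes>\<^bsub>D\<^esub> z) = \<phi> y \<otimes>\<^bsub>circle_group\<^esub> \<phi> z" if "y \<in> Q" "z \<in> Q" for y z
    using hom_mult[OF \<phi>] that Q(1) by blast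
  have closed: "\<phi> y \<in> carrier circle_group" if "y \<in> Q" for y
    using \<phi> that Q(1) by (auto simp: hom_def)
  show "\<phi> x \<in> carrier circle_group"
    using closed x .
  \<comment> \<open>Membership in \<open>hom\<close> gives only multiplicativity; the image of the
    identity is idempotent, hence trivial in a group.\<close>
  have "\<phi> \<one>\<^bsub>D\<^esub> = \<one>\<^bsub>circle_group\<^esub>"
    using mult[of "\<one>\<^bsub>D\<^esub>" "\<one>\<^bsub>D\<^esub>"] closed[of "\<one>\<^bsub>D\<^esub>"] Q(2) by simp
  then have "x [^]\<^bsub>D\<^esub> k \<in> Q \<and> \<phi> (x [^]\<^bsub>D\<^esub> k) = \<phi> x [^]\<^bsub>circle_group\<^esub> k" for k :: nat
    by (induction k) (use Q x mult in auto)
  then show "\<phi> x [^]\<^bsub>circle_group\<^esub> k \<in> small_arc" for k :: nat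
    using small by (metis image_subset_iff)
qed

lemma circle_hom_int:
  assumes closed: "\<And>c::int. g c \<in> carrier circle_group"
    and add: "\<And>c d. g (c + d) = g c \<otimes>\<^bsub>circle_group\<^esub> g d" and one: "g 1 = circle_of r"
  shows "g c = circle_of (of_int c * r)"
proof (induction c rule: int_induct[where k = 0])
  case base
  show ?case
    using add[of 0 0] closed[of 0] by (simp add: circle_of_0)
next
  case (step1 c)
  then show ?case
    by (simp add: add one circle_of_add[symmetric] algebra_simps)
next
  case (step2 c)
  have "g (c - 1) \<otimes>\<^bsub>circle_group\<^esub> circle_of r = circle_of (of_int c * r)"
    using add[of "c - 1" 1] step2(2) one by simp
  also have "\<dots> = circle_of (of_int (c - 1) * r) \<otimes>\<^bsub>circle_group\<^esub> circle_of r"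
    by (simp add: circle_of_add[symmetric] algebra_simps)
  finally show ?case
    using closed by simp
qed

subsection \<open>The dual of the Baer-Specker group\<close>

text \<open>Coordinate \<open>i\<close> of the power stands for evaluation at the sequence
  \<open>b i\<close>. All sequences occur, possibly several times.\<close>

locale int_sequence_index =
  fixes I :: "'i set" and b :: "'i \<Rightarrow> nat \<Rightarrow> int"
  assumes surj: "b ` I = UNIV"
begin

section \<open>The countable closed non-discrete subgroup\<close>

definition ev :: "((nat \<Rightarrow> int) \<Rightarrow> int) \<Rightarrow> 'i \<Rightarrow> int" where
  "ev h = (\<lambda>i\<in>I. h (b i))"

definition H :: "('i \<Rightarrow> int) set" where
  "H = ev ` {h. Modules.additive h}"

definition G :: "('i \<Rightarrow> int) monoid" where
  "G = (int_power_group I)\<lparr>carrier := H\<rparr>"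

definition T :: "('i \<Rightarrow> int) topology" where
  "T = subtopology (int_power_topology I) H"

definition index :: "(nat \<Rightarrow> int) \<Rightarrow> 'i" where
  "index x = inv_into I b x"

lemma index: "index x \<in> I" "b (index x) = x"
  using surj by (auto simp: index_def inv_into_into f_inv_into_f)

lemma ev_index [simp]: "ev h (index x) = h x"
  by (simp add: ev_def index)

lemma ev_in_H: "Modules.additive h \<Longrightarrow> ev h \<in> H"
  by (simp add: H_def)

lemma H_subset: "H \<subseteq> (\<Pi>\<^sub>E i\<in>I. UNIV)"
  by (auto simp: H_def ev_def)

lemma carrier_G [simp]: "carrier G = H"
  by (simp add: G_def)

lemma mult_ev: "ev f \<otimes>\<^bsub>G\<^esub> ev g = ev (\<lambda>x. f x + g x)"
  by (auto simp: G_def ev_def int_power_group_def)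

lemma subgroup_H: "subgroup H (int_power_group I)"
proof (rule group.subgroupI)
  show "group (int_power_group I)"
    by (simp add: int_power_group_def)
  show "H \<subseteq> carrier (int_power_group I)"
    using H_subset by (simp add: int_power_group_def)
  show "H \<noteq> {}"
    using ev_in_H[of "\<lambda>_. 0"] by (auto simp: Modules.additive_def)
  show "inv\<^bsub>int_power_group I\<^esub> f \<in> H" if f: "f \<in> H" for f
  proof -
    have "inv\<^bsub>int_power_group I\<^esub> f = (\<lambda>i\<in>I. - f i)"
      using f H_subset by (simp add: int_power_group_def inv_product_group subset_iff cong: restrict_cong)
    moreover obtain h where h: "Modules.additive h" "f = ev h"
      using f by (auto simp: H_def)
    ultimately have "inv\<^bsub>int_power_group I\<^esub> f = ev (\<lambda>x. - h x)"
      by (auto simp: ev_def)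
    moreover have "Modules.additive (\<lambda>x. - h x)"
      using h(1) by (simp add: Modules.additive_def)
    ultimately show ?thesis
      by (simp add: ev_in_H)
  qed
  show "f \<otimes>\<^bsub>int_power_group I\<^esub> g \<in> H" if fg: "f \<in> H" "g \<in> H" for f g
  proof -
    obtain h k where hk: "Modules.additive h" "f = ev h" "Modules.additive k" "g = ev k"
      using fg by (auto simp: H_def)
    moreover have "Modules.additive (\<lambda>x. h x + k x)"
      using hk by (simp add: Modules.additive_def)
    ultimately show ?thesis
      using mult_ev[of h k] ev_in_H by (simp add: G_def)
  qed
qed

lemma monoid_G: "monoid G"
  unfolding G_def
  by (intro group.is_monoid subgroup.subgroup_is_group subgroup_H) (simp add: int_power_group_def)

lemma topspace_T [simp]: "topspace T = H"
  using H_subset by (auto simp: T_def int_power_topology_def)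

lemma continuous_map_coordinate:
  assumes "i \<in> I"
  shows "continuous_map T (discrete_topology UNIV) (\<lambda>f. f i)"
  unfolding T_def int_power_topology_def
  by (intro continuous_map_from_subtopology continuous_map_product_projection assms)

text \<open>By Specker's theorem a member of \<open>H\<close> is determined by a finite list of
  integer coefficients.\<close>

lemma countable_H: "countable H"
proof (rule countable_subset)
  show "H \<subseteq> range (\<lambda>l. \<lambda>i\<in>I. \<Sum>j<length l. b i j * l ! j)"
  proof
    fix f assume "f \<in> H"
    then obtain h where h: "Modules.additive h" "f = ev h"
      by (auto simp: H_def)
    from h(1) obtain n where "\<And>x. h x = (\<Sum>j<n. x j * h (unit_seq j))"
      by (rule additive_finite_rank) blast
    then have "f = (\<lambda>i\<in>I. \<Sum>j<n. b i j * h (unit_seq j))"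
      unfolding h(2) ev_def by (intro restrict_ext)
    then have "f = (\<lambda>i\<in>I. \<Sum>j<length (map (\<lambda>j. h (unit_seq j)) [0..<n]).
        b i j * map (\<lambda>j. h (unit_seq j)) [0..<n] ! j)"
      by (auto intro!: restrict_ext sum.cong)
    then show "f \<in> range (\<lambda>l. \<lambda>i\<in>I. \<Sum>j<length l. b i j * l ! j)"
      by blast
  qed
qed auto

text \<open>Additivity is a family of equations between three coordinates each, and every such
  equation defines a closed set.\<close>

lemma closedin_H: "closedin (int_power_topology I) H"
proof -
  let ?X = "int_power_topology I"
  have topspace_X [simp]: "topspace ?X = (\<Pi>\<^sub>E i\<in>I. UNIV)"
    by (simp add: int_power_topology_def)
  have cont: "continuous_map ?X euclideanreal (\<lambda>f. of_int (f i))" if "i \<in> I" for i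
    using continuous_map_compose[OF continuous_map_product_projection[OF that, of "\<lambda>_. discrete_topology UNIV"],
        of euclideanreal of_int]
    by (simp add: int_power_topology_def o_def)
  have closed: "closedin ?X {f \<in> topspace ?X. f i = f j + f k}" if "i \<in> I" "j \<in> I" "k \<in> I" for i j k
  proof -
    have "closedin ?X {f \<in> topspace ?X. (of_int (f i) :: real) = of_int (f j) + of_int (f k)}"
      using that
      by (intro closedin_continuous_maps_eq[OF Hausdorff_space_euclidean] continuous_map_add cont)
    then show ?thesis
      by (simp only: of_int_add[symmetric] of_int_eq_iff)
  qed
  let ?S = "{(i, x, y). i \<in> I \<and> b i = x + y}"
  have ne: "?S \<noteq> {}"
    using index[of 0] by (auto intro!: exI[of _ "index 0"] exI[of _ 0])
  have "H = (\<Inter>(i, x, y)\<in>?S. {f \<in> topspace ?X. f i = f (index x) + f (index y)})" (is "H = ?C")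
  proof (intro equalityI subsetI)
    fix f assume "f \<in> H"
    then show "f \<in> ?C"
      using H_subset by (auto simp: H_def ev_def index Modules.additive_def)
  next
    fix f assume f: "f \<in> ?C"
    have add: "f i = f (index x) + f (index y)" if "i \<in> I" "b i = x + y" for i x y
      using f that by auto
    have "f \<in> topspace ?X"
      using f ne by fast
    have zero: "f (index 0) = 0"
      using add[of "index 0" 0 0] by (simp add: index)
    have "Modules.additive (\<lambda>x. f (index x))"
      by unfold_locales (simp add: add index)
    moreover have "f = ev (\<lambda>x. f (index x))"
    proof
      fix i show "f i = ev (\<lambda>x. f (index x)) i"
        using add[of i "b i" 0] zero \<open>f \<in> topspace ?X\<close> by (cases "i \<in> I") (auto simp: ev_def PiE_def extensional_def)
    qed
    ultimately show "f \<in> H"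
      using ev_in_H by metis
  qed
  also have "closedin ?X ?C"
    by (rule closedin_INT[OF ne]) (use closed index(1) in \<open>auto simp del: topspace_X\<close>)
  finally show ?thesis .
qed

text \<open>A basic neighbourhood restricts only finitely many coordinates. Adding a nonzero
  functional that vanishes at the corresponding sequences gives a second point in it.\<close>

lemma not_openin_singleton: "\<not> openin T {f}"
proof
  assume "openin T {f}"
  then obtain V where V: "openin (int_power_topology I) V" "{f} = V \<inter> H"
    by (auto simp: T_def openin_subtopology)
  then have "f \<in> V" "f \<in> H"
    by auto
  then obtain h where h: "Modules.additive h" "f = ev h"
    by (auto simp: H_def)
  obtain U where U: "finite {i \<in> I. U i \<noteq> UNIV}" "f \<in> Pi\<^sub>E I U" "Pi\<^sub>E I U \<subseteq> V"
    using V(1) \<open>f \<in> V\<close> unfolding int_power_topology_def openin_product_topology_alt by auto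
  obtain k m where k: "Modules.additive k" "k (unit_seq m) \<noteq> (0::int)"
      "\<forall>x\<in>b ` {i \<in> I. U i \<noteq> UNIV}. k x = 0"
    using additive_vanishing_on_finite[OF finite_imageI[OF U(1), of b], of 0] by metis
  have "ev (\<lambda>x. h x + k x) \<in> H"
    using h(1) k(1) by (intro ev_in_H) (simp add: Modules.additive_def)
  moreover have "ev (\<lambda>x. h x + k x) \<in> Pi\<^sub>E I U"
  proof (rule PiE_I)
    fix i assume "i \<in> I"
    then show "ev (\<lambda>x. h x + k x) i \<in> U i"
      using U(2) k(3) by (cases "U i = UNIV") (auto simp: ev_def h(2) PiE_iff)
  qed (simp add: ev_def)
  ultimately have "ev (\<lambda>x. h x + k x) = ev h"
    using U(3) V(2) h(2) by blast
  then have "ev (\<lambda>x. h x + k x) (index (unit_seq m)) = ev h (index (unit_seq m))"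
    by simp
  then show False
    using k(2) by simp
qed

text \<open>Each coordinate takes finitely many values on \<open>K\<close>, being a compact image in
  a discrete space, so the gliding hump argument applies.\<close>

lemma compact_bounded_support:
  assumes "compactin T K"
  shows "\<exists>n. \<forall>h. Modules.additive h \<longrightarrow> ev h \<in> K \<longrightarrow> (\<forall>j\<ge>n. h (unit_seq j) = 0)"
proof -
  have "finite ((\<lambda>h. h x) ` {h. Modules.additive h \<and> ev h \<in> K})" for x
  proof (rule finite_subset)
    show "finite ((\<lambda>f. f (index x)) ` K)"
      using image_compactin[OF assms continuous_map_coordinate[OF index(1)]]
      by (simp add: compactin_discrete_topology)
    show "(\<lambda>h. h x) ` {h. Modules.additive h \<and> ev h \<in> K} \<subseteq> (\<lambda>f. f (index x)) ` K"
    proof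
      fix k assume "k \<in> (\<lambda>h. h x) ` {h. Modules.additive h \<and> ev h \<in> K}"
      then obtain h where "k = h x" "ev h \<in> K"
        by blast
      then show "k \<in> (\<lambda>f. f (index x)) ` K"
        by (intro image_eqI[of _ _ "ev h"]) simp_all
    qed
  qed
  from pointwise_finite_imp_bounded_support[OF _ this] show ?thesis
    by auto
qed

section \<open>Neighbourhoods of the trivial character in the dual\<close>

abbreviation dualG :: "(('i \<Rightarrow> int) \<Rightarrow> real set) monoid" where
  "dualG \<equiv> dual_group G T"

abbreviation dualT :: "(('i \<Rightarrow> int) \<Rightarrow> real set) topology" where
  "dualT \<equiv> dual_topology G T"

lemma monoid_dualG: "monoid dualG"
  by (rule monoid_dual_group) (simp_all add: monoid_G)

text \<open>By \<open>additive_eq_sum\<close> the functionals in question are the integer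
  combinations of the first \<open>n\<close> projections.\<close>

definition annihilator :: "nat \<Rightarrow> (('i \<Rightarrow> int) \<Rightarrow> real set) set" where
  "annihilator n = {\<kappa> \<in> carrier dualG. \<forall>h. Modules.additive h \<longrightarrow>
     (\<forall>j\<ge>n. h (unit_seq j) = 0) \<longrightarrow> \<kappa> (ev h) = \<one>\<^bsub>circle_group\<^esub>}"

lemma annihilator_subset: "annihilator n \<subseteq> carrier dualG"
  by (auto simp: annihilator_def)

lemma annihilator_one: "\<one>\<^bsub>dualG\<^esub> \<in> annihilator n"
  using monoid.one_closed[OF monoid_dualG]
  by (simp add: annihilator_def) (simp add: dual_one_eq ev_in_H)

lemma annihilator_mult:
  assumes "\<kappa> \<in> annihilator n" "\<psi> \<in> annihilator n"
  shows "\<kappa> \<otimes>\<^bsub>dualG\<^esub> \<psi> \<in> annihilator n"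
  using assms monoid.m_closed[OF monoid_dualG, of \<kappa> \<psi>]
  by (simp add: annihilator_def) (simp add: dual_mult_eq ev_in_H)

lemma annihilator_0: "annihilator 0 = carrier dualG"
proof
  show "carrier dualG \<subseteq> annihilator 0"
  proof
    fix \<kappa> assume \<kappa>: "\<kappa> \<in> carrier dualG"
    have "\<kappa> (ev h) = \<one>\<^bsub>circle_group\<^esub>" if h: "Modules.additive h" "\<forall>j. h (unit_seq j) = 0" for h
    proof -
      have "h x = 0" for x
        using additive_eq_0 h by blast
      then have "ev h \<otimes>\<^bsub>G\<^esub> ev h = ev h"
        by (simp only: mult_ev) (simp add: ev_def)
      then show ?thesis
        using dual_apply_mult[OF \<kappa>, of "ev h" "ev h"] dual_apply_closed[OF \<kappa>, of "ev h"] ev_in_H[OF h(1)]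
        by simp
    qed
    with \<kappa> show "\<kappa> \<in> annihilator 0"
      by (simp add: annihilator_def)
  qed
qed (rule annihilator_subset)

text \<open>A compact set involves only the first \<open>n\<close> projections for some
  \<open>n\<close>, so characters in \<open>annihilator n\<close> agree on it with the trivial
  one.\<close>

lemma openin_dualT_annihilator:
  assumes W: "openin dualT W" "\<one>\<^bsub>dualG\<^esub> \<in> W"
  shows "\<exists>n. annihilator n \<subseteq> W"
proof (rule dual_topology_local_base[OF W])
  show "antimono annihilator"
  proof (rule antimonoI)
    fix m n :: nat assume "m \<le> n"
    then have "\<forall>j\<ge>m. h (unit_seq j) = 0 \<Longrightarrow> \<forall>j\<ge>n. h (unit_seq j) = (0::int)" for h
      using order_trans by blast
    then show "annihilator n \<subseteq> annihilator m"
      unfolding annihilator_def by blast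
  qed
next
  fix K U
  assume K: "compactin T K" and U: "\<one>\<^bsub>dualG\<^esub> ` K \<subseteq> U"
  obtain n where n: "\<And>h j. Modules.additive h \<Longrightarrow> ev h \<in> K \<Longrightarrow> n \<le> j \<Longrightarrow> h (unit_seq j) = 0"
    using compact_bounded_support[OF K] by blast
  have "K \<subseteq> H"
    using compactin_subset_topspace[OF K] by simp
  have "\<kappa> f \<in> U" if "\<kappa> \<in> annihilator n" "f \<in> K" for \<kappa> f
  proof -
    obtain h where h: "Modules.additive h" "f = ev h"
      using \<open>K \<subseteq> H\<close> \<open>f \<in> K\<close> by (auto simp: H_def)
    then have "\<kappa> f = \<one>\<^bsub>circle_group\<^esub>"
      using that n[OF h(1)] by (auto simp: annihilator_def)
    also have "\<dots> = \<one>\<^bsub>dualG\<^esub> f"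
      using \<open>K \<subseteq> H\<close> \<open>f \<in> K\<close> by (auto simp: dual_one_eq)
    finally show ?thesis
      using U \<open>f \<in> K\<close> by auto
  qed
  then show "\<exists>n. annihilator n \<subseteq> {\<psi> \<in> carrier dualG. \<psi> ` K \<subseteq> U}"
    using annihilator_subset by blast
qed

section \<open>The compact union of circles of characters\<close>

definition coord_char :: "nat \<Rightarrow> real \<Rightarrow> ('i \<Rightarrow> int) \<Rightarrow> real set" where
  "coord_char m r = (\<lambda>f\<in>H. circle_of (r * of_int (f (index (unit_seq m)))))"

lemma coord_char_ev:
  "Modules.additive h \<Longrightarrow> coord_char m r (ev h) = circle_of (r * of_int (h (unit_seq m)))"
  by (simp add: coord_char_def ev_in_H)

lemma coord_char_closed: "coord_char m r \<in> carrier dualG"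
proof -
  have "continuous_map (discrete_topology UNIV) circle_topology (\<lambda>k. circle_of (r * of_int k))"
    by simp
  from continuous_map_compose[OF continuous_map_coordinate[OF index(1)] this]
  have "continuous_map T circle_topology (\<lambda>f. circle_of (r * of_int (f (index (unit_seq m)))))"
    by (simp add: o_def)
  then have "continuous_map T circle_topology (coord_char m r)"
    by (rule continuous_map_eq) (simp add: coord_char_def)
  moreover have "coord_char m r (f \<otimes>\<^bsub>G\<^esub> g) = coord_char m r f \<otimes>\<^bsub>circle_group\<^esub> coord_char m r g"
    if fg: "f \<in> H" "g \<in> H" for f g
  proof -
    have "f \<otimes>\<^bsub>G\<^esub> g \<in> H"
      using monoid.m_closed[OF monoid_G] fg by simp
    moreover have "(f \<otimes>\<^bsub>G\<^esub> g) (index x) = f (index x) + g (index x)" for x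
      using index(1) by (simp add: G_def int_power_group_def)
    ultimately show ?thesis
      using fg by (simp add: coord_char_def circle_of_add[symmetric] algebra_simps)
  qed
  then have "coord_char m r \<in> hom G circle_group"
    by (intro homI) (auto simp: coord_char_def)
  ultimately show ?thesis
    by (simp add: dual_carrier_iff) (simp add: coord_char_def)
qed

lemma coord_char_mult: "coord_char m r \<otimes>\<^bsub>dualG\<^esub> coord_char m s = coord_char m (r + s)"
  by (simp add: dual_mult_eq coord_char_def circle_of_add[symmetric] distrib_right cong: restrict_cong)

lemma coord_char_0: "coord_char m 0 = \<one>\<^bsub>dualG\<^esub>"
  by (simp add: dual_one_eq coord_char_def circle_of_0)

lemma coord_char_annihilator:
  assumes "n \<le> m"
  shows "coord_char m r \<in> annihilator n"
  using assms by (simp add: annihilator_def coord_char_closed coord_char_ev circle_of_0)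

text \<open>On a compact \<open>K\<close> the relevant coordinate has finitely many values, so the
  preimage of a subbasic set is a finite intersection of open sets.\<close>

lemma continuous_map_coord_char: "continuous_map euclidean dualT (coord_char m)"
  unfolding dual_topology_def
proof (rule continuous_on_generated_topo)
  fix S assume "S \<in> {{\<phi> \<in> carrier dualG. \<phi> ` K \<subseteq> U} |K U. compactin T K \<and> openin circle_topology U}"
  then obtain K U where S: "S = {\<phi> \<in> carrier dualG. \<phi> ` K \<subseteq> U}" and K: "compactin T K"
      and U: "openin circle_topology U"
    by blast
  define V where "V = (\<lambda>f. f (index (unit_seq m))) ` K"
  have "finite V"
    using image_compactin[OF K continuous_map_coordinate[OF index(1)]]
    by (simp add: compactin_discrete_topology V_def)
  have "K \<subseteq> H"
    using compactin_subset_topspace[OF K] by simp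
  then have "coord_char m -` S = (\<Inter>k\<in>V. (\<lambda>r. r * of_int k) -` {x. circle_of x \<in> U})"
    by (auto simp: S coord_char_closed V_def) (auto simp: coord_char_def subset_iff)
  moreover have "open {x. circle_of x \<in> U}"
    using U by (simp add: openin_circle_topology circle_of_def)
  ultimately have "open (coord_char m -` S)"
    using \<open>finite V\<close> by (simp only:) (intro open_INT ballI open_vimage continuous_intros)
  then show "openin euclidean (coord_char m -` S \<inter> topspace euclidean)"
    by simp
next
  have "\<Union> {{\<phi> \<in> carrier dualG. \<phi> ` K \<subseteq> U} |K U. compactin T K \<and> openin circle_topology U} = carrier dualG"
    using topspace_dual_topology[of G T] by (simp only: dual_topology_def topology_generated_by_topspace)
  then show "coord_char m ` topspace euclidean \<subseteq>
      \<Union> {{\<phi> \<in> carrier dualG. \<phi> ` K \<subseteq> U} |K U. compactin T K \<and> openin circle_topology U}"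
    using coord_char_closed by (simp only: image_subset_iff) simp
qed

lemma compactin_range_coord_char: "compactin dualT (range (coord_char m))"
proof -
  \<comment> \<open>The parameter matters only modulo 1, since it is multiplied by integers; hence
    the circle is the image of the compact unit interval.\<close>
  have "coord_char m r = coord_char m (frac r)" for r
  proof -
    have "circle_of (r * of_int k) = circle_of (frac r * of_int k)" for k :: int
      by (auto simp: circle_of_eq_iff frac_def left_diff_distrib)
    then show ?thesis
      by (simp add: coord_char_def)
  qed
  moreover have "frac r \<in> {0..1}" for r :: real
    by (simp add: frac_ge_0 frac_lt_1 less_imp_le)
  ultimately have "range (coord_char m) = coord_char m ` {0..1}"
    by (metis (no_types, lifting) image_subset_iff rangeI subset_antisym image_mono subset_UNIV image_eqI)
  moreover have "compactin euclidean {0..1::real}"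
    by simp
  ultimately show ?thesis
    using image_compactin[OF _ continuous_map_coord_char] by metis
qed

definition circles :: "(('i \<Rightarrow> int) \<Rightarrow> real set) set" where
  "circles = (\<Union>m. range (coord_char m))"

text \<open>A covering set containing the trivial character contains some
  \<open>annihilator n\<close>, and with it all circles from index \<open>n\<close> on. Finitely
  many compact circles remain.\<close>

lemma compactin_circles: "compactin dualT circles"
  unfolding compactin_def
proof (intro conjI allI impI)
  show "circles \<subseteq> topspace dualT"
    using coord_char_closed by (auto simp: circles_def)
  fix \<U> assume \<U>: "(\<forall>U\<in>\<U>. openin dualT U) \<and> circles \<subseteq> \<Union>\<U>"
  have "\<one>\<^bsub>dualG\<^esub> \<in> circles"
    by (auto simp: circles_def coord_char_0[of 0, symmetric])
  then obtain W where W: "W \<in> \<U>" "\<one>\<^bsub>dualG\<^esub> \<in> W"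
    using \<U> by blast
  then obtain n where n: "annihilator n \<subseteq> W"
    using openin_dualT_annihilator \<U> by blast
  have "compactin dualT (\<Union>m<n. range (coord_char m))"
    by (rule compactin_Union) (use compactin_range_coord_char in auto)
  moreover have "(\<Union>m<n. range (coord_char m)) \<subseteq> \<Union>\<U>"
    using \<U> unfolding circles_def by blast
  ultimately obtain \<F> where \<F>: "finite \<F>" "\<F> \<subseteq> \<U>" "(\<Union>m<n. range (coord_char m)) \<subseteq> \<Union>\<F>"
    using \<U> unfolding compactin_def by meson
  have "coord_char m r \<in> \<Union>(insert W \<F>)" for m r
  proof (cases "m < n")
    case True
    then show ?thesis
      using \<F>(3) by blast
  next
    case False
    then show ?thesis
      using coord_char_annihilator[of n m r] n by auto
  qed
  then have "circles \<subseteq> \<Union>(insert W \<F>)"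
    unfolding circles_def by blast
  with \<F> W show "\<exists>\<F>. finite \<F> \<and> \<F> \<subseteq> \<U> \<and> circles \<subseteq> \<Union>\<F>"
    by (intro exI[of _ "insert W \<F>"]) auto
qed

section \<open>Discreteness of the bidual\<close>

lemma annihilator_Suc:
  assumes \<kappa>: "\<kappa> \<in> annihilator n"
  shows "\<exists>r. \<kappa> \<otimes>\<^bsub>dualG\<^esub> coord_char n r \<in> annihilator (Suc n)"
proof -
  have \<kappa>c: "\<kappa> \<in> carrier dualG"
    using \<kappa> annihilator_subset by blast
  have add: "Modules.additive (\<lambda>x. c * x n)" for c :: int
    by (simp add: Modules.additive_def algebra_simps)
  \<comment> \<open>Along the multiples of the \<open>n\<close>-th projection,
    \<open>\<kappa>\<close> is \<open>c\<close> times some \<open>r\<close> modulo 1, so the circle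
    character with parameter \<open>- r\<close> cancels it there.\<close>
  define g where "g = (\<lambda>c. \<kappa> (ev (\<lambda>x. c * x n)))"
  have g_closed: "g c \<in> carrier circle_group" for c
    unfolding g_def by (rule dual_apply_closed[OF \<kappa>c]) (simp add: ev_in_H add)
  then obtain r where r: "g 1 = circle_of r"
    using carrier_circle_group by blast
  have g_add: "g (c + d) = g c \<otimes>\<^bsub>circle_group\<^esub> g d" for c d
    unfolding g_def
    by (subst dual_apply_mult[OF \<kappa>c, symmetric]) (simp_all add: ev_in_H add mult_ev algebra_simps)
  have g: "g c = circle_of (of_int c * r)" for c
    by (rule circle_hom_int[OF g_closed g_add r])
  have "(\<kappa> \<otimes>\<^bsub>dualG\<^esub> coord_char n (- r)) (ev h) = \<one>\<^bsub>circle_group\<^esub>"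
    if h: "Modules.additive h" "\<forall>j\<ge>Suc n. h (unit_seq j) = 0" for h
  proof -
    \<comment> \<open>Splitting off the \<open>n\<close>-th coefficient leaves a functional on which
      \<open>\<kappa>\<close> is already trivial.\<close>
    define h' where "h' = (\<lambda>x. h x - h (unit_seq n) * x n)"
    have h': "Modules.additive h'"
      using h(1) by (simp add: h'_def Modules.additive_def algebra_simps)
    have "h' (unit_seq j) = 0" if "n \<le> j" for j
      using that h(2) by (cases "j = n") (auto simp: h'_def unit_seq_def)
    then have "\<kappa> (ev h') = \<one>\<^bsub>circle_group\<^esub>"
      using \<kappa> h' by (auto simp: annihilator_def)
    moreover have "ev h = ev h' \<otimes>\<^bsub>G\<^esub> ev (\<lambda>x. h (unit_seq n) * x n)"
      by (simp add: mult_ev h'_def)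
    ultimately have "\<kappa> (ev h) = circle_of (of_int (h (unit_seq n)) * r)"
      using dual_apply_mult[OF \<kappa>c, of "ev h'" "ev (\<lambda>x. h (unit_seq n) * x n)"]
        g[of "h (unit_seq n)"] by (simp add: ev_in_H h' add g_def)
    then show ?thesis
      using h(1)
      by (simp add: dual_mult_eq ev_in_H coord_char_ev circle_of_add[symmetric] circle_of_0 algebra_simps)
  qed
  then have "\<kappa> \<otimes>\<^bsub>dualG\<^esub> coord_char n (- r) \<in> annihilator (Suc n)"
    unfolding annihilator_def
    using monoid.m_closed[OF monoid_dualG \<kappa>c coord_char_closed] by blast
  then show ?thesis ..
qed

text \<open>Each circle is a subgroup, so \<open>\<phi>\<close> is trivial on it. Continuity makes
  \<open>\<phi>\<close> small, hence trivial, on some \<open>annihilator n\<close>, and corrections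
  by circle characters extend this to the whole dual.\<close>

lemma bidual_small_on_circles:
  assumes \<phi>: "\<phi> \<in> carrier (dual_group dualG dualT)" and small: "\<phi> ` circles \<subseteq> small_arc"
  shows "\<phi> = \<one>\<^bsub>dual_group dualG dualT\<^esub>"
proof -
  have \<phi>_hom: "\<phi> \<in> hom dualG circle_group" and \<phi>_ext: "\<phi> \<in> extensional (carrier dualG)"
      and \<phi>_cont: "continuous_map dualT circle_topology \<phi>"
    using \<phi> by (auto simp: dual_carrier_iff)
  have circ: "\<phi> (coord_char m r) = \<one>\<^bsub>circle_group\<^esub>" for m r
  proof (rule hom_trivial_if_small[OF monoid_dualG \<phi>_hom])
    show "range (coord_char m) \<subseteq> carrier dualG"
      using coord_char_closed by auto
    show "\<one>\<^bsub>dualG\<^esub> \<in> range (coord_char m)"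
      using coord_char_0 by (metis rangeI)
    show "\<phi> ` range (coord_char m) \<subseteq> small_arc"
      using small by (auto simp: circles_def)
  qed (auto simp: coord_char_mult)
  let ?W = "{\<kappa> \<in> topspace dualT. \<phi> \<kappa> \<in> small_arc}"
  have "openin dualT ?W"
    by (rule openin_continuous_map_preimage[OF \<phi>_cont openin_small_arc])
  moreover have "\<one>\<^bsub>dualG\<^esub> \<in> ?W"
    using circ[of 0 0] monoid.one_closed[OF monoid_dualG] one_in_small_arc by (simp add: coord_char_0)
  ultimately obtain n where n: "annihilator n \<subseteq> ?W"
    using openin_dualT_annihilator by blast
  have "\<forall>\<kappa>\<in>annihilator n. \<phi> \<kappa> = \<one>\<^bsub>circle_group\<^esub>"
    using n annihilator_one annihilator_mult
    by (intro ballI hom_trivial_if_small[OF monoid_dualG \<phi>_hom annihilator_subset]) auto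
  \<comment> \<open>Descent from \<open>n\<close> to 0: multiplying by a suitable circle character
    moves \<open>\<kappa>\<close> into the next annihilator without changing its image under
    \<open>\<phi>\<close>.\<close>
  then have "\<forall>\<kappa>\<in>annihilator 0. \<phi> \<kappa> = \<one>\<^bsub>circle_group\<^esub>"
  proof (induction n)
    case (Suc n)
    have "\<phi> \<kappa> = \<one>\<^bsub>circle_group\<^esub>" if \<kappa>: "\<kappa> \<in> annihilator n" for \<kappa>
    proof -
      have \<kappa>c: "\<kappa> \<in> carrier dualG"
        using \<kappa> annihilator_subset by blast
      obtain r where "\<kappa> \<otimes>\<^bsub>dualG\<^esub> coord_char n r \<in> annihilator (Suc n)"
        using annihilator_Suc[OF \<kappa>] by blast
      then have "\<one>\<^bsub>circle_group\<^esub> = \<phi> (\<kappa> \<otimes>\<^bsub>dualG\<^esub> coord_char n r)"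
        using Suc.prems by simp
      also have "\<dots> = \<phi> \<kappa> \<otimes>\<^bsub>circle_group\<^esub> \<phi> (coord_char n r)"
        by (rule hom_mult[OF \<phi>_hom \<kappa>c coord_char_closed])
      also have "\<dots> = \<phi> \<kappa>"
        using dual_apply_closed[OF \<phi> \<kappa>c] by (simp add: circ)
      finally show ?thesis ..
    qed
    then show ?case
      using Suc.IH by blast
  qed
  then show ?thesis
    using \<phi>_ext by (intro extensionalityI[of _ "carrier dualG"]) (auto simp: dual_one_eq annihilator_0)
qed

text \<open>The singleton is itself the subbasic set given by the compact \<open>circles\<close> and
  the open \<open>small_arc\<close>.\<close>

lemma openin_bidual_one:
  "openin (dual_topology dualG dualT) {\<one>\<^bsub>dual_group dualG dualT\<^esub>}"
proof -
  have "\<one>\<^bsub>dual_group dualG dualT\<^esub> \<in> carrier (dual_group dualG dualT)"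
    by (intro monoid.one_closed monoid_dual_group monoid_dualG topspace_dual_topology)
  moreover have "\<one>\<^bsub>dual_group dualG dualT\<^esub> ` circles \<subseteq> small_arc"
    using one_in_small_arc coord_char_closed by (auto simp: dual_one_eq circles_def)
  ultimately have eq: "{\<phi> \<in> carrier (dual_group dualG dualT). \<phi> ` circles \<subseteq> small_arc} =
      {\<one>\<^bsub>dual_group dualG dualT\<^esub>}"
    using bidual_small_on_circles by blast
  show ?thesis
    unfolding eq[symmetric] by (rule openin_dual_topology_subbasis[OF compactin_circles openin_small_arc])
qed

text \<open>A homeomorphism would carry the open singleton of the bidual to an open singleton of
  \<open>H\<close>.\<close>

lemma not_reflexive: "\<not> reflexive_group G T"
proof
  assume "reflexive_group G T"
  then obtain f where "homeomorphic_map (dual_topology dualG dualT) T f"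
    by (auto simp: reflexive_group_def top_isomorphic_def)
  then have "open_map (dual_topology dualG dualT) T f"
    by (rule homeomorphic_imp_open_map)
  then have "openin T (f ` {\<one>\<^bsub>dual_group dualG dualT\<^esub>})"
    using openin_bidual_one by (simp only: open_map_def)
  then show False
    using not_openin_singleton by simp
qed

end

theorem corollary3p5:
  fixes I :: "'i set"
  assumes "I \<approx> (UNIV :: real set)"
  shows "\<exists>H. subgroup H (int_power_group I) \<and>
             countable H \<and>
             closedin (int_power_topology I) H \<and>
             \<not> reflexive_group ((int_power_group I)\<lparr>carrier := H\<rparr>)
                               (subtopology (int_power_topology I) H)"
proof -
  obtain b where "b ` I = (UNIV :: (nat \<Rightarrow> int) set)"
    using surj_onto_int_sequences[OF assms] by blast
  then interpret int_sequence_index I b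
    by unfold_locales
  show ?thesis
    using subgroup_H countable_H closedin_H not_reflexive by (auto simp: G_def T_def)
qed

end
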